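(* Let $\epsilon\in(0,3/4)$, $\lambda>0$, and suppose $$\mu\ge\frac{2}{3-4\epsilon}\Big(L(1-\epsilon)+3\sqrt{1+\epsilon}\,L'+2\hat L^2\frac{1+\epsilon}{\lambda}\Big),\qquad\hat L=\max\{L,L'\}.$$ Then for all $X\in\mathrm{St}(p,n)^\epsilon$ and all $g\in\mathbb R^{n\times p}$, $$\langle\tilde\Lambda(X;g),\nabla m(X)\rangle\ge\frac14\|\mathrm{grad}f(X)\|_F^2+\lambda\mu\,\mathcal N(X)+\frac14\|\mathrm{skew}(gX^\top)X\|_F^2-\|g-\nabla f(X)\|_F^2.$$
   Context: $n\ge p\ge1$ and $N\ge1$ are integers; $\|\cdot\|_F$ is the Frobenius norm, $\langle X,Y\rangle=\mathrm{Tr}(X^\top Y)$, $\mathrm{sym}(M)=\frac12(M+M^\top)$, $\mathrm{skew}(M)=\frac12(M-M^\top)$; $\mathrm{St}(p,n)^\epsilon=\{X\in\mathbb R^{n\times p}:\|X^\top X-I_p\|_F\le\epsilon\}$. $f=\frac1N\sum_{i=1}^Nf_i$ with $f_i(X)=\mathbb E_{\xi_i\sim\mathcal D_i}F(X;\xi_i)$, $f$ twice differentiable, and: - $\|\nabla F(X;\xi_i)\|_F\le L'$ for all $X\in\mathrm{St}(p,n)^\epsilon$, all $i$, all $\xi_i\sim\mathcal D_i$; and $\mathbb E_{\xi_i}[\nabla F(X;\xi_i)]=\nabla f_i(X)$ (so $\|\nabla f(X)\|_F\le L'$ on $\mathrm{St}(p,n)^\epsilon$); - $\nabla f_i$ is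 $L_i$-Lipschitz on $\mathrm{St}(p,n)^\epsilon$ for each $i$ (Frobenius norm), and $L$ denotes the Lipschitz constant of $\nabla f$ on $\mathrm{St}(p,n)^\epsilon$. $\mathcal N(X)=\frac14\|X^\top X-I_p\|_F^2$, $\nabla\mathcal N(X)=X(X^\top X-I_p)$, $\mathrm{grad}f(X)=\mathrm{skew}(\nabla f(X)X^\top)X$, $\tilde\Lambda(X;g)=\mathrm{skew}(gX^\top)X+\lambda\nabla\mathcal N(X)$. The merit function is $m(X)=f(X)-h(X)+\mu\mathcal N(X)$ with $h(X)=\frac12\langle\mathrm{sym}(X^\top\nabla f(X)),X^\top X-I_p\rangle$. *)

theory Defs
  imports "HOL-Probability.Probability"
begin

text \<open>
  Real n-by-p matrices are the type \<^typ>\<open>real ^ 'p ^ 'n\<close>.  Its library inner product and norm are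
  the Frobenius ones, as the next two lemmas confirm.
\<close>

lemma inner_eq_trace_transpose:
  fixes X Y :: "real ^ 'p ^ 'n"
  shows "X \<bullet> Y = trace (transpose X ** Y)"
  unfolding inner_vec_def trace_def matrix_matrix_mult_def transpose_def
  by (simp, subst sum.swap, rule refl)

lemma norm_eq_sqrt_sum_squares:
  fixes X :: "real ^ 'p ^ 'n"
  shows "norm X = sqrt (\<Sum>i\<in>UNIV. \<Sum>j\<in>UNIV. (X $ i $ j)\<^sup>2)"
  by (simp add: norm_eq_sqrt_inner inner_vec_def power2_eq_square)

text \<open>The gradient with respect to the inner product; unspecified where \<open>f\<close> is not differentiable.\<close>

definition nabla :: "('a::euclidean_space \<Rightarrow> real) \<Rightarrow> 'a \<Rightarrow> 'a" where
  "nabla f X = (THE G. GDERIV f X :> G)"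

lemma nabla_eqI: "GDERIV f X :> G \<Longrightarrow> nabla f X = G"
  unfolding nabla_def
proof (rule the_equality)
  fix H assume "GDERIV f X :> G" "GDERIV f X :> H"
  then have "(\<lambda>h. h \<bullet> H) = (\<lambda>h. h \<bullet> G)"
    unfolding gderiv_def by (rule has_derivative_unique[rotated])
  then show "H = G" by (metis inner_commute vector_eq_rdot)
qed

lemma GDERIV_nabla:
  fixes f :: "'a::euclidean_space \<Rightarrow> real"
  assumes "f differentiable at X"
  shows "GDERIV f X :> nabla f X"
proof -
  obtain f' where f': "(f has_derivative f') (at X)"
    using assms by (auto simp: differentiable_def)
  then have "linear f'" by (rule has_derivative_linear)
  then have "f' = (\<lambda>h. h \<bullet> adjoint f' 1)"
    by (auto simp: adjoint_works)
  with f' have "GDERIV f X :> adjoint f' 1" by (simp add: gderiv_def)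
  then show ?thesis by (simp add: nabla_eqI)
qed

definition twice_differentiable :: "('a::euclidean_space \<Rightarrow> real) \<Rightarrow> bool" where
  "twice_differentiable f \<longleftrightarrow>
     (\<forall>X. f differentiable at X) \<and> (\<forall>X. nabla f differentiable at X)"

definition sym_part :: "real ^ 'n ^ 'n \<Rightarrow> real ^ 'n ^ 'n" where
  "sym_part M = (1/2) *\<^sub>R (M + transpose M)"

definition skew_part :: "real ^ 'n ^ 'n \<Rightarrow> real ^ 'n ^ 'n" where
  "skew_part M = (1/2) *\<^sub>R (M - transpose M)"

definition St_nbhd :: "real \<Rightarrow> (real ^ 'p ^ 'n) set" where
  "St_nbhd \<epsilon> = {X. norm (transpose X ** X - mat 1) \<le> \<epsilon>}"

definition penalty :: "real ^ 'p ^ 'n \<Rightarrow> real" where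
  "penalty X = 1/4 * (norm (transpose X ** X - mat 1))\<^sup>2"

lemma nabla_penalty:
  fixes X :: "real ^ 'p ^ 'n"
  shows "nabla penalty X = X ** (transpose X ** X - mat 1)"
proof (rule nabla_eqI)
  define S where "S = transpose X ** X - mat 1"
  have adj: "(transpose A ** B) \<bullet> C = B \<bullet> (A ** C)"
    for A :: "real ^ 'p ^ 'n" and B :: "real ^ 'p ^ 'n" and C
    by (simp add: inner_eq_trace_transpose matrix_transpose_mul matrix_mul_assoc)
  have tr: "transpose A \<bullet> transpose B = A \<bullet> B" for A B :: "real ^ 'p ^ 'p"
    unfolding inner_vec_def transpose_def by (simp, subst sum.swap, rule refl)
  have S: "transpose S = S"
    by (auto simp: S_def transpose_def matrix_matrix_mult_def mat_def vec_eq_iff mult.commute)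
  have mult: "bounded_bilinear (\<lambda>A B :: real ^ 'p ^ 'n. transpose A ** B)"
    unfolding bilinear_conv_bounded_bilinear[symmetric] bilinear_def
    by (auto intro!: linearI simp: matrix_matrix_mult_def transpose_def vec_eq_iff
        algebra_simps sum.distrib sum_distrib_left)
  have 1: "((\<lambda>X. transpose X ** X - mat 1) has_derivative
             (\<lambda>V. transpose X ** V + transpose V ** X)) (at X)"
    using bounded_bilinear.FDERIV[OF mult has_derivative_ident has_derivative_ident]
    by (auto intro!: derivative_eq_intros)
  have 2: "(transpose V ** X) \<bullet> S = V \<bullet> (X ** S)" for V
    using tr[of "transpose V ** X" S] by (simp add: matrix_transpose_mul S adj)
  have 3: "S \<bullet> (transpose X ** V + transpose V ** X) = 2 * (V \<bullet> (X ** S))" for V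
    using adj[of X V S] 2[of V] inner_commute[of S "transpose X ** V + transpose V ** X"]
    by (simp add: inner_add_left)
  have "(penalty has_derivative (\<lambda>V. V \<bullet> (X ** S))) (at X)"
    unfolding penalty_def power2_norm_eq_inner
    by (rule derivative_eq_intros 1 refl)+
       (simp add: S_def[symmetric] 3 inner_commute[of _ S])
  then show "GDERIV penalty X :> X ** (transpose X ** X - mat 1)"
    by (simp add: gderiv_def S_def)
qed

definition rgrad :: "(real ^ 'p ^ 'n \<Rightarrow> real) \<Rightarrow> real ^ 'p ^ 'n \<Rightarrow> real ^ 'p ^ 'n" where
  "rgrad f X = skew_part (nabla f X ** transpose X) ** X"

definition landing :: "real \<Rightarrow> real ^ 'p ^ 'n \<Rightarrow> real ^ 'p ^ 'n \<Rightarrow> real ^ 'p ^ 'n" where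
  "landing lam X g = skew_part (g ** transpose X) ** X + lam *\<^sub>R nabla penalty X"

definition hterm :: "(real ^ 'p ^ 'n \<Rightarrow> real) \<Rightarrow> real ^ 'p ^ 'n \<Rightarrow> real" where
  "hterm f X = 1/2 * (sym_part (transpose X ** nabla f X) \<bullet> (transpose X ** X - mat 1))"

definition merit :: "(real ^ 'p ^ 'n \<Rightarrow> real) \<Rightarrow> real \<Rightarrow> real ^ 'p ^ 'n \<Rightarrow> real" where
  "merit f \<mu> X = f X - hterm f X + \<mu> * penalty X"

end

theory Submission
  imports Defs
begin

text \<open>
  Write \<open>S = X\<^sup>T X - I\<close>, \<open>G = \<nabla>f(X)\<close>, \<open>H = D(\<nabla>f)(X)\<close>, and \<open>A\<close>, \<open>B\<close> for the skew parts of
  \<open>g X\<^sup>T\<close> and \<open>G X\<^sup>T\<close>.  Since \<open>A X\<close> is orthogonal to \<open>X M\<close> for every symmetric \<open>M\<close>, the inner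
  product splits into \<open>A \<bullet> B\<close>, terms quadratic in \<open>S\<close>, and cross terms between \<open>A\<close> and \<open>X S\<close>, which
  are at most \<open>sqrt (1 + \<epsilon>) * Lhat * norm A * norm (X S)\<close>.  From
  \<open>norm (A - B) \<le> sqrt (1 + \<epsilon>) * norm (g - G)\<close> and \<open>1 + \<epsilon> \<le> 2\<close>, polarisation gives
  \<open>A \<bullet> B + (norm (g - G))\<^sup>2 \<ge> (norm A)\<^sup>2 / 2 + (norm B)\<^sup>2 / 2\<close>; the part of this not needed for the two
  quarter terms is \<open>(1 - \<epsilon>) / 4 * (norm A)\<^sup>2\<close>, and AM-GM absorbs the cross terms in it and in the
  penalty term, using \<open>(norm (X S))\<^sup>2 \<ge> (1 - \<epsilon>) * (norm S)\<^sup>2\<close>.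
  At a boundary point of the neighbourhood the Lipschitz condition only sees inward directions;
  linearity and continuity of \<open>H\<close> extend the bound \<open>norm (H V) \<le> L * norm V\<close> to all \<open>V\<close>.
\<close>

section \<open>Transposes, adjoints and the Frobenius norm of a product\<close>

lemma inner_transpose_transpose:
  fixes A B :: "real ^ 'm ^ 'n"
  shows "transpose A \<bullet> transpose B = A \<bullet> B"
  unfolding inner_vec_def transpose_def by (simp, subst sum.swap, rule refl)

lemma norm_transpose:
  fixes A :: "real ^ 'm ^ 'n"
  shows "norm (transpose A) = norm A"
  by (simp add: norm_eq_sqrt_inner inner_transpose_transpose)

lemma transpose_diff: "transpose (A - B) = transpose A - transpose B"
  for A B :: "real ^ 'm ^ 'n"
  by (simp add: transpose_def vec_eq_iff)

lemma transpose_add: "transpose (A + B) = transpose A + transpose B"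
  for A B :: "real ^ 'm ^ 'n"
  by (simp add: transpose_def vec_eq_iff)

lemma matrix_mul_left_adjoint:
  fixes A :: "real ^ 'k ^ 'n"
  shows "(A ** B) \<bullet> C = B \<bullet> (transpose A ** C)"
  by (simp add: inner_eq_trace_transpose matrix_transpose_mul matrix_mul_assoc)

lemma matrix_mul_right_adjoint:
  fixes A :: "real ^ 'k ^ 'n"
  shows "(A ** B) \<bullet> C = A \<bullet> (C ** transpose B)"
  using inner_transpose_transpose[of "A ** B" C]
    inner_transpose_transpose[of A "C ** transpose B"]
    matrix_mul_left_adjoint[of "transpose B" "transpose A" "transpose C"]
  by (simp add: matrix_transpose_mul)

text \<open>Each entry of the product pairs a row of \<open>A\<close> with a column of
  \<open>B\<close>; Cauchy-Schwarz bounds its square, and the double sum of the bounds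
  factorises.\<close>

lemma norm_matrix_mul_le:
  fixes A :: "real ^ 'k ^ 'n" and B :: "real ^ 'm ^ 'k"
  shows "norm (A ** B) \<le> norm A * norm B"
proof -
  have entry: "((A ** B) $ i $ j)\<^sup>2 \<le> (norm (A $ i))\<^sup>2 * (norm (transpose B $ j))\<^sup>2" for i j
  proof -
    have "(A ** B) $ i $ j = A $ i \<bullet> transpose B $ j"
      by (simp add: matrix_matrix_mult_def transpose_def inner_vec_def)
    then show ?thesis
      by (metis Cauchy_Schwarz_ineq power2_norm_eq_inner)
  qed
  have rows: "(\<Sum>i\<in>UNIV. (norm (M $ i))\<^sup>2) = (norm M)\<^sup>2" for M :: "real ^ 'a ^ 'b"
    by (simp add: power2_norm_eq_inner inner_vec_def)
  have "(norm (A ** B))\<^sup>2 = (\<Sum>i\<in>UNIV. \<Sum>j\<in>UNIV. ((A ** B) $ i $ j)\<^sup>2)"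
    by (simp add: norm_eq_sqrt_sum_squares sum_nonneg)
  also have "\<dots> \<le> (\<Sum>i\<in>UNIV. \<Sum>j\<in>UNIV. (norm (A $ i))\<^sup>2 * (norm (transpose B $ j))\<^sup>2)"
    by (intro sum_mono entry)
  also have "\<dots> = (norm A * norm B)\<^sup>2"
    by (simp only: sum_product[symmetric] rows norm_transpose power_mult_distrib)
  finally show ?thesis
    by (rule power2_le_imp_le) simp
qed

text \<open>Serves twice: it supplies the product rule for derivatives and, through
  \<open>matrix_mul_simps\<close>, the algebraic laws. Submultiplicativity provides the constant
  1.\<close>

lemma bounded_bilinear_matrix_mul:
  "bounded_bilinear ((**) :: real ^ 'k ^ 'n \<Rightarrow> real ^ 'm ^ 'k \<Rightarrow> real ^ 'm ^ 'n)"
proof -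
  have *: "(c *\<^sub>R A) ** B = c *\<^sub>R (A ** B)" "A ** (c *\<^sub>R B) = c *\<^sub>R (A ** B)"
    "(A + A') ** B = A ** B + A' ** B"
    for c and A A' :: "real ^ 'k ^ 'n" and B :: "real ^ 'm ^ 'k"
    by (simp_all add: matrix_matrix_mult_def vec_eq_iff sum_distrib_left mult_ac
        distrib_left sum.distrib)
  show ?thesis
    by unfold_locales
       (auto simp: matrix_add_ldistrib * norm_matrix_mul_le intro!: exI[of _ 1])
qed

lemma bounded_linear_transpose: "bounded_linear (transpose :: real ^ 'm ^ 'n \<Rightarrow> _)"
  by (rule linear_conv_bounded_linear[THEN iffD1], rule linearI)
     (simp_all add: transpose_def vec_eq_iff)

lemmas matrix_mul_simps =
  bounded_bilinear.diff_left[OF bounded_bilinear_matrix_mul]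
  bounded_bilinear.diff_right[OF bounded_bilinear_matrix_mul]
  bounded_bilinear.add_left[OF bounded_bilinear_matrix_mul]
  bounded_bilinear.add_right[OF bounded_bilinear_matrix_mul]
  bounded_bilinear.scaleR_left[OF bounded_bilinear_matrix_mul]
  bounded_bilinear.scaleR_right[OF bounded_bilinear_matrix_mul]
  bounded_bilinear.minus_left[OF bounded_bilinear_matrix_mul]
  bounded_bilinear.minus_right[OF bounded_bilinear_matrix_mul]

lemma transpose_scaleR: "transpose (c *\<^sub>R A) = c *\<^sub>R transpose A"
  for A :: "real ^ 'm ^ 'n"
  by (simp add: transpose_def vec_eq_iff)

section \<open>Symmetric and skew parts\<close>

lemma transpose_sym_part: "transpose (sym_part M) = sym_part M"
  by (simp add: sym_part_def transpose_add transpose_scaleR add.commute)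

lemma transpose_skew_part: "transpose (skew_part M) = - skew_part M"
  by (simp add: skew_part_def transpose_diff transpose_scaleR flip: scaleR_minus_right)

text \<open>Transposition preserves the inner product, so \<open>M\<close> and its transpose pair
  equally with a symmetric \<open>T\<close>.\<close>

lemma sym_part_inner:
  assumes "transpose T = T"
  shows "sym_part M \<bullet> T = M \<bullet> T"
  using inner_transpose_transpose[of M T] assms
  by (simp add: sym_part_def inner_add_left)

lemma inner_skew_part:
  assumes "transpose T = - T"
  shows "T \<bullet> skew_part M = T \<bullet> M"
  using inner_transpose_transpose[of T M] assms
  by (simp add: skew_part_def inner_diff_right)

lemma skew_inner_sym:
  fixes A B :: "real ^ 'n ^ 'n"
  assumes "transpose A = - A" "transpose B = B"
  shows "A \<bullet> B = 0"
  using inner_transpose_transpose[of A B] assms by simp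

lemma norm_sym_part_le: "norm (sym_part M) \<le> norm M"
  using norm_triangle_ineq[of M "transpose M"] by (simp add: sym_part_def norm_transpose)

lemma norm_skew_part_le: "norm (skew_part M) \<le> norm M"
  using norm_triangle_ineq4[of M "transpose M"] by (simp add: skew_part_def norm_transpose)

lemma skew_part_diff: "skew_part (M - M') = skew_part M - skew_part M'"
  by (simp add: skew_part_def transpose_diff algebra_simps)

section \<open>Multiplication by a matrix of the neighbourhood\<close>

lemma transpose_gram_diff:
  "transpose (transpose X ** X - mat 1) = transpose X ** X - (mat 1 :: real ^ 'p ^ 'p)"
  for X :: "real ^ 'p ^ 'n"
  by (simp add: transpose_diff matrix_transpose_mul transpose_mat)

text \<open>Moving \<open>X\<close> across the inner product leaves \<open>(norm M)\<^sup>2\<close>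
  plus \<open>M \<bullet> (S ** M)\<close>, and \<open>norm S \<le> \<epsilon>\<close> controls the
  perturbation. This replaces a statement on the singular values of \<open>X\<close>.\<close>

lemma norm_mul_St_nbhd:
  fixes X :: "real ^ 'p ^ 'n" and M :: "real ^ 'q ^ 'p"
  assumes "X \<in> St_nbhd \<epsilon>"
  shows "(1 - \<epsilon>) * (norm M)\<^sup>2 \<le> (norm (X ** M))\<^sup>2"
    and "(norm (X ** M))\<^sup>2 \<le> (1 + \<epsilon>) * (norm M)\<^sup>2"
proof -
  define S where "S = transpose X ** X - mat 1"
  have "norm S \<le> \<epsilon>"
    using assms by (simp add: St_nbhd_def S_def)
  have "(norm (X ** M))\<^sup>2 = M \<bullet> ((S + mat 1) ** M)"
    by (simp add: S_def power2_norm_eq_inner matrix_mul_left_adjoint matrix_mul_assoc)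
  also have "\<dots> = (norm M)\<^sup>2 + M \<bullet> (S ** M)"
    by (simp add: matrix_mul_simps inner_add_right power2_norm_eq_inner)
  finally have eq: "(norm (X ** M))\<^sup>2 = (norm M)\<^sup>2 + M \<bullet> (S ** M)" .
  have "\<bar>M \<bullet> (S ** M)\<bar> \<le> norm M * norm (S ** M)"
    by (rule Cauchy_Schwarz_ineq2)
  also have "\<dots> \<le> norm M * (\<epsilon> * norm M)"
    using norm_matrix_mul_le[of S M] mult_right_mono[OF \<open>norm S \<le> \<epsilon>\<close>, of "norm M"]
    by (intro mult_left_mono) auto
  finally have "\<bar>M \<bullet> (S ** M)\<bar> \<le> \<epsilon> * (norm M)\<^sup>2"
    by (simp add: power2_eq_square mult_ac)
  then show "(1 - \<epsilon>) * (norm M)\<^sup>2 \<le> (norm (X ** M))\<^sup>2"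
    and "(norm (X ** M))\<^sup>2 \<le> (1 + \<epsilon>) * (norm M)\<^sup>2"
    unfolding eq by (simp_all add: algebra_simps)
qed

lemma norm_mul_St_nbhd_le:
  fixes X :: "real ^ 'p ^ 'n" and M :: "real ^ 'q ^ 'p"
  assumes "X \<in> St_nbhd \<epsilon>"
  shows "norm (X ** M) \<le> sqrt (1 + \<epsilon>) * norm M"
  using real_sqrt_le_mono[OF norm_mul_St_nbhd(2)[OF assms, of M]]
  by (simp add: real_sqrt_mult)

text \<open>By duality: pairing \<open>transpose X ** M\<close> with itself and moving
  \<open>X\<close> to the other factor reduces to multiplication by \<open>X\<close>; one factor of
  the norm is then cancelled.\<close>

lemma norm_transpose_mul_St_nbhd_le:
  fixes X :: "real ^ 'p ^ 'n" and M :: "real ^ 'q ^ 'n"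
  assumes "X \<in> St_nbhd \<epsilon>"
  shows "norm (transpose X ** M) \<le> sqrt (1 + \<epsilon>) * norm M"
proof (cases "transpose X ** M = 0")
  case True
  \<comment> \<open>The right-hand side must be nonnegative, and membership in the neighbourhood
    forces this sign of \<epsilon>.\<close>
  have "0 \<le> \<epsilon>"
    using assms norm_ge_zero order_trans unfolding St_nbhd_def by blast
  with True show ?thesis by simp
next
  case False
  define Y where "Y = transpose X ** M"
  have "norm Y * norm Y = Y \<bullet> Y"
    by (metis power2_eq_square power2_norm_eq_inner)
  also have "\<dots> = M \<bullet> (X ** Y)"
    using matrix_mul_left_adjoint[of "transpose X" M Y] by (simp add: Y_def)
  also have "\<dots> \<le> norm M * (sqrt (1 + \<epsilon>) * norm Y)"
    by (rule order_trans[OF norm_cauchy_schwarz])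
       (intro mult_left_mono norm_mul_St_nbhd_le assms norm_ge_zero)
  finally have "norm Y * norm Y \<le> (sqrt (1 + \<epsilon>) * norm M) * norm Y"
    by (simp add: mult_ac)
  then show ?thesis
    using False by (simp add: Y_def)
qed

lemma norm_mul_transpose_St_nbhd_le:
  fixes X :: "real ^ 'p ^ 'n" and M :: "real ^ 'p ^ 'q"
  assumes "X \<in> St_nbhd \<epsilon>"
  shows "norm (M ** transpose X) \<le> sqrt (1 + \<epsilon>) * norm M"
  using norm_mul_St_nbhd_le[OF assms, of "transpose M"]
  by (metis matrix_transpose_mul norm_transpose transpose_transpose)

lemma norm_mul_right_St_nbhd_le:
  fixes X :: "real ^ 'p ^ 'n" and M :: "real ^ 'n ^ 'q"
  assumes "X \<in> St_nbhd \<epsilon>"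
  shows "norm (M ** X) \<le> sqrt (1 + \<epsilon>) * norm M"
  using norm_transpose_mul_St_nbhd_le[OF assms, of "transpose M"]
  by (metis matrix_transpose_mul norm_transpose)

section \<open>Differentiability of the penalty\<close>

lemma has_derivative_gram_diff:
  fixes X :: "real ^ 'p ^ 'n"
  shows "((\<lambda>X. transpose X ** X - mat 1) has_derivative
           (\<lambda>V. transpose X ** V + transpose V ** X)) (at X)"
  using bounded_bilinear.FDERIV[OF bounded_bilinear_matrix_mul
      bounded_linear_imp_has_derivative[OF bounded_linear_transpose] has_derivative_ident, of X]
  by (auto intro!: derivative_eq_intros)

lemma penalty_differentiable: "penalty differentiable at X"
proof -
  have "(\<lambda>X. transpose X ** X - mat 1) differentiable at X"
    using has_derivative_gram_diff by (rule differentiableI)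
  then show ?thesis
    unfolding penalty_def power2_norm_eq_inner by simp
qed

lemma GDERIV_penalty: "GDERIV penalty X :> X ** (transpose X ** X - mat 1)"
  using GDERIV_nabla[OF penalty_differentiable] by (simp add: nabla_penalty)

section \<open>From the Lipschitz condition to a bound on the derivative\<close>

text \<open>A one-sided difference quotient already determines \<open>F' V\<close>, so it is enough
  that the ray from \<open>x\<close> along \<open>V\<close> starts inside \<open>T\<close>. This
  covers boundary points.\<close>

lemma lipschitz_on_derivative_bound:
  fixes F :: "'a::real_normed_vector \<Rightarrow> 'b::real_normed_vector"
  assumes lip: "L-lipschitz_on T F" and der: "(F has_derivative F') (at x)"
    and x: "x \<in> T" and ev: "\<forall>\<^sub>F t in at_right 0. x + t *\<^sub>R V \<in> T"
  shows "norm (F' V) \<le> L * norm V"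
proof -
  have "((\<lambda>t. F (x + t *\<^sub>R V)) has_derivative (\<lambda>t. F' (t *\<^sub>R V))) (at 0)"
    by (rule has_derivative_compose[of "\<lambda>t. x + t *\<^sub>R V" "\<lambda>t. t *\<^sub>R V" 0 UNIV F F', simplified])
       (auto intro!: derivative_eq_intros der)
  then have "((\<lambda>t. norm (F (x + t *\<^sub>R V) - F x - t *\<^sub>R F' V) / norm t) \<longlongrightarrow> 0) (at 0)"
    by (simp add: has_derivative_at linear_cmul[OF has_derivative_linear[OF der]])
  then have "((\<lambda>t. norm (F (x + t *\<^sub>R V) - F x - t *\<^sub>R F' V) / norm t) \<longlongrightarrow> 0) (at_right 0)"
    by (rule tendsto_within_subset) simp
  then have lim: "((\<lambda>t. norm (F (x + t *\<^sub>R V) - F x - t *\<^sub>R F' V) / norm t + L * norm V)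
      \<longlongrightarrow> 0 + L * norm V) (at_right 0)"
    by (intro tendsto_intros)
  have "\<forall>\<^sub>F t in at_right 0.
      norm (F' V) \<le> norm (F (x + t *\<^sub>R V) - F x - t *\<^sub>R F' V) / norm t + L * norm V"
    using ev eventually_at_right_less[of 0]
  proof eventually_elim
    case (elim t)
    have "t * norm (F' V) = norm (t *\<^sub>R F' V)"
      using elim by simp
    also have "\<dots> \<le> norm (F (x + t *\<^sub>R V) - F x - t *\<^sub>R F' V) + norm (F (x + t *\<^sub>R V) - F x)"
      by (metis norm_triangle_sub norm_minus_commute add.commute)
    also have "norm (F (x + t *\<^sub>R V) - F x) \<le> L * (t * norm V)"
      using lipschitz_onD[OF lip elim(1) x] elim(2) by (simp add: dist_norm)
    finally show ?case
      using elim(2) by (simp add: field_simps)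
  qed
  then show ?thesis
    using tendsto_lowerbound[OF lim] by simp
qed

text \<open>Directions with \<open>V \<bullet> P < 0\<close> lower the penalty, whose sublevel sets
  are the neighbourhoods, so the ray stays inside. As \<open>P\<close> is nonzero, these directions
  form an open half-space; its closure and the negative of that closure cover everything.\<close>

lemma St_nbhd_derivative_bound:
  fixes F :: "real ^ 'p ^ 'n \<Rightarrow> 'b::real_normed_vector"
  assumes lip: "L-lipschitz_on (St_nbhd \<epsilon>) F" and der: "(F has_derivative F') (at X)"
    and X: "X \<in> St_nbhd \<epsilon>" and nz: "nabla penalty X \<noteq> 0"
  shows "norm (F' V) \<le> L * norm V"
proof -
  define P where "P = nabla penalty X"
  have lin: "linear F'"
    using der by (rule has_derivative_linear)
  have neg: "norm (F' V) \<le> L * norm V" if "V \<bullet> P < 0" for V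
  proof (rule lipschitz_on_derivative_bound[OF lip der X])
    have "(penalty has_derivative (\<lambda>h. h \<bullet> P)) (at X)"
      using GDERIV_nabla[OF penalty_differentiable] by (simp add: gderiv_def P_def)
    then have "((\<lambda>t. penalty (X + t *\<^sub>R V)) has_derivative (\<lambda>t. (t *\<^sub>R V) \<bullet> P)) (at 0)"
      by (intro has_derivative_compose[of "\<lambda>t. X + t *\<^sub>R V" "\<lambda>t. t *\<^sub>R V" 0 UNIV penalty, simplified])
         (auto intro!: derivative_eq_intros)
    then have "((\<lambda>t. penalty (X + t *\<^sub>R V)) has_real_derivative V \<bullet> P) (at 0)"
      unfolding has_field_derivative_def
      by (rule has_derivative_eq_rhs) (simp add: fun_eq_iff)
    from DERIV_neg_dec_right[OF this that] obtain d where d: "d > 0"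
      "\<And>h. 0 < h \<Longrightarrow> h < d \<Longrightarrow> penalty (X + h *\<^sub>R V) < penalty X"
      by auto
    have "X + h *\<^sub>R V \<in> St_nbhd \<epsilon>" if "0 < h" "h < d" for h
    proof -
      have "norm (transpose (X + h *\<^sub>R V) ** (X + h *\<^sub>R V) - mat 1)
          \<le> norm (transpose X ** X - mat 1)"
        by (rule power2_le_imp_le[OF less_imp_le])
           (use d(2)[OF that] in \<open>simp_all add: penalty_def\<close>)
      with X show ?thesis
        by (simp add: St_nbhd_def)
    qed
    then show "\<forall>\<^sub>F t in at_right 0. X + t *\<^sub>R V \<in> St_nbhd \<epsilon>"
      using d(1) unfolding eventually_at_right_field by auto
  qed
  have nonpos: "norm (F' V) \<le> L * norm V" if "V \<bullet> P \<le> 0" for V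
  proof -
    \<comment> \<open>Subtracting a small multiple of \<open>P\<close> tilts \<open>V\<close> into
      the open half-space; the bound survives as \<open>t\<close> tends to 0.\<close>
    have "((\<lambda>t. norm (F' (V - t *\<^sub>R P))) \<longlongrightarrow> norm (F' (V - 0 *\<^sub>R P))) (at_right 0)"
      by (intro tendsto_norm bounded_linear.tendsto[OF has_derivative_bounded_linear[OF der]]
          tendsto_intros)
    moreover have "((\<lambda>t. L * norm (V - t *\<^sub>R P)) \<longlongrightarrow> L * norm (V - 0 *\<^sub>R P)) (at_right 0)"
      by (intro tendsto_intros)
    moreover have "\<forall>\<^sub>F t in at_right 0. norm (F' (V - t *\<^sub>R P)) \<le> L * norm (V - t *\<^sub>R P)"
      using eventually_at_right_less[of 0]
    proof eventually_elim
      case (elim t)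
      have "0 < t * (P \<bullet> P)"
        using elim nz by (simp add: P_def)
      with that have "(V - t *\<^sub>R P) \<bullet> P < 0"
        by (simp add: inner_diff_left)
      then show ?case
        by (rule neg)
    qed
    ultimately show ?thesis
      using tendsto_le[of "at_right (0::real)"] by (auto simp: trivial_limit_at_right_real)
  qed
  show ?thesis
    \<comment> \<open>One of \<open>V\<close> and \<open>- V\<close> lies in the closed half-space,
      and both sides of the bound are even in \<open>V\<close>.\<close>
    using nonpos[of V] nonpos[of "- V"] linear_neg[OF lin, of V] by fastforce
qed

section \<open>Gradient of the merit function\<close>

text \<open>The product rule for \<open>hterm\<close> differentiates both factors. Pairing with
  \<open>V\<close> keeps the second derivative of \<open>f\<close> in the form \<open>H V\<close>,
  which is what the Lipschitz condition bounds.\<close>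

lemma inner_nabla_merit:
  fixes f :: "real ^ 'p ^ 'n \<Rightarrow> real"
  assumes f: "f differentiable at X" and H: "(nabla f has_derivative H) (at X)"
  defines "S \<equiv> transpose X ** X - mat 1"
  shows "V \<bullet> nabla (merit f \<mu>) X =
           V \<bullet> nabla f X - V \<bullet> (X ** sym_part (transpose X ** nabla f X))
           - 1/2 * (V \<bullet> (nabla f X ** S)) - 1/2 * (H V \<bullet> (X ** S)) + \<mu> * (V \<bullet> (X ** S))"
proof -
  define G where "G = nabla f X"
  define M where "M = sym_part (transpose X ** G)"
  have Ssym: "transpose S = S"
    by (simp add: S_def transpose_gram_diff)
  have lin: "bounded_linear (sym_part :: real ^ 'p ^ 'p \<Rightarrow> _)"
    unfolding sym_part_def
    by (intro bounded_linear_compose[OF bounded_linear_scaleR_right] bounded_linear_add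
        bounded_linear_ident bounded_linear_transpose)
  have d1: "((\<lambda>X. transpose X ** nabla f X) has_derivative
              (\<lambda>V. transpose X ** H V + transpose V ** G)) (at X)"
    using bounded_bilinear.FDERIV[OF bounded_bilinear_matrix_mul
        bounded_linear_imp_has_derivative[OF bounded_linear_transpose] H]
    by (simp add: G_def)
  have dh: "(hterm f has_derivative
      (\<lambda>V. 1/2 * (M \<bullet> (transpose X ** V + transpose V ** X)
              + sym_part (transpose X ** H V + transpose V ** G) \<bullet> S))) (at X)"
    unfolding hterm_def M_def G_def[symmetric] S_def
    by (rule has_derivative_eq_rhs[OF has_derivative_mult_right[OF has_derivative_inner[OF
          bounded_linear.has_derivative[OF lin d1] has_derivative_gram_diff]]])
       (simp add: G_def)
  have df: "(f has_derivative (\<lambda>V. V \<bullet> G)) (at X)"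
    using GDERIV_nabla[OF f] by (simp add: gderiv_def G_def)
  have dp: "(penalty has_derivative (\<lambda>V. V \<bullet> (X ** S))) (at X)"
    using GDERIV_penalty[of X] by (simp add: gderiv_def S_def)
  have dm: "(merit f \<mu> has_derivative
      (\<lambda>V. V \<bullet> G - 1/2 * (M \<bullet> (transpose X ** V + transpose V ** X)
              + sym_part (transpose X ** H V + transpose V ** G) \<bullet> S) + \<mu> * (V \<bullet> (X ** S)))) (at X)"
    unfolding merit_def by (intro derivative_intros df dh dp)
  then have "(merit f \<mu>) differentiable at X"
    by (rule differentiableI)
  then have "(merit f \<mu> has_derivative (\<lambda>V. V \<bullet> nabla (merit f \<mu>) X)) (at X)"
    using GDERIV_nabla by (simp add: gderiv_def)
  from fun_cong[OF has_derivative_unique[OF this dm], of V]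
  have eq: "V \<bullet> nabla (merit f \<mu>) X =
    V \<bullet> G - 1/2 * (M \<bullet> (transpose X ** V + transpose V ** X)
       + sym_part (transpose X ** H V + transpose V ** G) \<bullet> S) + \<mu> * (V \<bullet> (X ** S))" .
  \<comment> \<open>Since \<open>M\<close> is symmetric, both halves of the derivative of the Gram
    matrix pair with it equally; this doubling cancels the factor 1/2 in
    \<open>hterm\<close>.\<close>
  have m1: "M \<bullet> (transpose X ** V) = V \<bullet> (X ** M)"
    using matrix_mul_left_adjoint[of X M V] by (simp add: inner_commute)
  have m2: "M \<bullet> (transpose V ** X) = V \<bullet> (X ** M)"
    using inner_transpose_transpose[of M "transpose V ** X"] m1
    by (simp add: M_def transpose_sym_part matrix_transpose_mul)
  have s1: "(transpose X ** H V) \<bullet> S = H V \<bullet> (X ** S)"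
    by (simp add: matrix_mul_left_adjoint)
  have s2: "(transpose V ** G) \<bullet> S = V \<bullet> (G ** S)"
    using inner_transpose_transpose[of "transpose V ** G" S]
    by (simp add: Ssym matrix_transpose_mul matrix_mul_left_adjoint)
  show ?thesis
    unfolding eq sym_part_inner[OF Ssym]
    by (simp add: inner_add_left inner_add_right m1 m2 s1 s2 field_simps flip: G_def M_def)
qed

section \<open>Gradient bound for the averaged objective\<close>

text \<open>The norm of an expectation is at most the expectation of the norm, and averaging over
  \<open>i\<close> preserves a common bound.\<close>

lemma norm_nabla_average_le:
  fixes D :: "nat \<Rightarrow> 'x measure" and F :: "'a::euclidean_space \<Rightarrow> 'x \<Rightarrow> real"
    and fi :: "nat \<Rightarrow> 'a \<Rightarrow> real" and f :: "'a \<Rightarrow> real"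
  assumes N: "N \<ge> 1"
    and prob: "\<And>i. i \<in> {1..N} \<Longrightarrow> prob_space (D i)"
    and f: "\<And>Y. f Y = 1 / real N * (\<Sum>i = 1..N. fi i Y)"
    and bound: "\<And>i. i \<in> {1..N} \<Longrightarrow> AE \<xi> in D i. norm (nabla (\<lambda>Y. F Y \<xi>) X) \<le> B"
    and diff: "\<And>i. i \<in> {1..N} \<Longrightarrow> fi i differentiable at X"
    and int: "\<And>i. i \<in> {1..N} \<Longrightarrow>
       has_bochner_integral (D i) (\<lambda>\<xi>. nabla (\<lambda>Y. F Y \<xi>) X) (nabla (fi i) X)"
  shows "norm (nabla f X) \<le> B"
proof -
  have le: "norm (nabla (fi i) X) \<le> B" if i: "i \<in> {1..N}" for i
  proof -
    interpret prob_space "D i"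
      by (rule prob[OF i])
    have "norm (nabla (fi i) X) = norm (\<integral>\<xi>. nabla (\<lambda>Y. F Y \<xi>) X \<partial>D i)"
      using has_bochner_integral_integral_eq[OF int[OF i]] by simp
    also have "\<dots> \<le> (\<integral>\<xi>. norm (nabla (\<lambda>Y. F Y \<xi>) X) \<partial>D i)"
      by (rule integral_norm_bound)
    also have "\<dots> \<le> B"
      using int[OF i] bound[OF i]
      by (intro integral_le_const integrable_norm) (auto simp: has_bochner_integral_iff)
    finally show ?thesis .
  qed
  have "(f has_derivative (\<lambda>h. 1 / real N * (\<Sum>i = 1..N. h \<bullet> nabla (fi i) X))) (at X)"
    unfolding f[abs_def]
    by (intro has_derivative_mult_right has_derivative_sum)
       (use GDERIV_nabla[OF diff] in \<open>simp add: gderiv_def\<close>)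
  then have "GDERIV f X :> (1 / real N) *\<^sub>R (\<Sum>i = 1..N. nabla (fi i) X)"
    by (simp add: gderiv_def inner_sum_right)
  then have "norm (nabla f X) = 1 / real N * norm (\<Sum>i = 1..N. nabla (fi i) X)"
    by (simp add: nabla_eqI)
  also have "\<dots> \<le> 1 / real N * (real N * B)"
    using sum_norm_bound[of "{1..N}" "\<lambda>i. nabla (fi i) X" B] le
    by (intro mult_left_mono) auto
  finally show ?thesis
    using N by simp
qed

section \<open>The scalar inequality behind the condition on \<mu>\<close>

text \<open>Here \<open>u\<close>, \<open>y\<close>, \<open>z\<close> stand for the norms of \<open>A\<close>, \<open>S\<close>, \<open>X S\<close>.\<close>

lemma merit_budget:
  fixes u y z \<epsilon> lam \<mu> L L' Lhat :: real
  assumes eps: "0 < \<epsilon>" "\<epsilon> < 3/4" and lam: "0 < lam" and L: "0 \<le> L" "0 \<le> L'"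
    and yz: "(1 - \<epsilon>) * y\<^sup>2 \<le> z\<^sup>2"
    and mu: "\<mu> \<ge> 2 / (3 - 4 * \<epsilon>) *
           (L * (1 - \<epsilon>) + 3 * sqrt (1 + \<epsilon>) * L' + 2 * Lhat\<^sup>2 * ((1 + \<epsilon>) / lam))"
  shows "lam * \<mu> * z\<^sup>2 + (1 - \<epsilon>) / 4 * u\<^sup>2 \<ge>
           lam * \<mu> * y\<^sup>2 / 4 + lam * L * z\<^sup>2 / 2 + 3/2 * lam * sqrt (1 + \<epsilon>) * L' * y\<^sup>2
           + sqrt (1 + \<epsilon>) * Lhat * u * z"
proof -
  define c where "c = sqrt (1 + \<epsilon>)"
  define K where "K = L * (1 - \<epsilon>) + 3 * c * L' + 2 * Lhat\<^sup>2 * ((1 + \<epsilon>) / lam)"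
  \<comment> \<open>Both squared norms are compared with \<open>w\<close>: \<open>z\<^sup>2\<close>
    equals \<open>(1 - \<epsilon>) * w\<close>, and \<open>y\<^sup>2\<close> is at most
    \<open>w\<close>.\<close>
  define w where "w = z\<^sup>2 / (1 - \<epsilon>)"
  have c: "c \<ge> 0" "c\<^sup>2 = 1 + \<epsilon>"
    using eps by (auto simp: c_def)
  have "K \<ge> 0"
    using eps lam L c by (simp add: K_def)
  have muK: "\<mu> * (3 - 4 * \<epsilon>) \<ge> 2 * K"
    using mu eps by (simp add: K_def c_def field_simps)
  have "0 \<le> 2 / (3 - 4 * \<epsilon>) * K"
    using \<open>K \<ge> 0\<close> eps by simp
  then have "\<mu> \<ge> 0"
    using mu by (simp add: K_def c_def)
  have zw: "z\<^sup>2 = (1 - \<epsilon>) * w"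
    using eps by (simp add: w_def)
  have yw: "y\<^sup>2 \<le> w"
    using yz eps by (simp add: w_def field_simps)
  have "w \<ge> 0"
    using eps by (simp add: w_def)
  have amgm: "c * Lhat * u * z \<le> (1 - \<epsilon>) / 4 * u\<^sup>2 + (1 + \<epsilon>) * Lhat\<^sup>2 * w"
  proof -
    have square: "a / 4 * (u - 2 * q / a)\<^sup>2 = a / 4 * u\<^sup>2 - q * u + q\<^sup>2 / a" if "a \<noteq> 0" for a q
      using that by (simp add: power2_eq_square field_simps)
    \<comment> \<open>The square is weighted so that its \<open>u\<^sup>2\<close> term uses exactly
      the available \<open>(1 - \<epsilon>) / 4\<close>.\<close>
    have "0 \<le> (1 - \<epsilon>) / 4 * (u - 2 * (c * Lhat * z) / (1 - \<epsilon>))\<^sup>2"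
      using eps by simp
    also have "\<dots> = (1 - \<epsilon>) / 4 * u\<^sup>2 - c * Lhat * z * u + (c * Lhat * z)\<^sup>2 / (1 - \<epsilon>)"
      using eps by (intro square) simp
    finally show ?thesis
      by (simp add: c w_def power_mult_distrib mult_ac)
  qed
  have "lam * (2 * K) * w / 4 \<le> lam * (\<mu> * (3 - 4 * \<epsilon>)) * w / 4"
    using muK lam \<open>w \<ge> 0\<close> by (intro divide_right_mono mult_right_mono mult_left_mono) auto
  \<comment> \<open>The three summands of \<open>K\<close> pay, in order, for the second-derivative
    term, the cubic penalty term and the AM-GM remainder.\<close>
  moreover have "lam * (2 * K) * w / 4 =
      lam * L * z\<^sup>2 / 2 + 3/2 * lam * c * L' * w + (1 + \<epsilon>) * Lhat\<^sup>2 * w"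
    using lam by (simp add: K_def zw field_simps)
  \<comment> \<open>Here \<open>3 - 4 * \<epsilon>\<close> is
    \<open>4 * (1 - \<epsilon>) - 1\<close>: the available penalty term minus the quarter reserved
    for the conclusion.\<close>
  moreover have "lam * (\<mu> * (3 - 4 * \<epsilon>)) * w / 4 = lam * \<mu> * z\<^sup>2 - lam * \<mu> * w / 4"
    by (simp add: zw field_simps)
  moreover have "lam * \<mu> * y\<^sup>2 / 4 \<le> lam * \<mu> * w / 4"
    using yw lam \<open>\<mu> \<ge> 0\<close> by (intro divide_right_mono mult_left_mono) auto
  moreover have "3/2 * lam * c * L' * y\<^sup>2 \<le> 3/2 * lam * c * L' * w"
    using yw lam c L by (intro mult_left_mono) auto
  ultimately show ?thesis
    using amgm unfolding c_def[symmetric] by linarith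
qed

section \<open>The descent inequality at a fixed point\<close>

lemma landing_inner_nabla_merit_ge:
  fixes f :: "real ^ 'p ^ 'n \<Rightarrow> real" and g :: "real ^ 'p ^ 'n"
  assumes f: "twice_differentiable f" and X: "X \<in> St_nbhd \<epsilon>"
    and bound: "norm (nabla f X) \<le> L'"
    and lip: "L-lipschitz_on (St_nbhd \<epsilon>) (nabla f)"
    and eps: "0 < \<epsilon>" "\<epsilon> < 3/4" and lam: "0 < lam" and Lhat: "Lhat = max L L'"
    and mu: "\<mu> \<ge> 2 / (3 - 4 * \<epsilon>) *
           (L * (1 - \<epsilon>) + 3 * sqrt (1 + \<epsilon>) * L' + 2 * Lhat\<^sup>2 * ((1 + \<epsilon>) / lam))"
  shows "landing lam X g \<bullet> nabla (merit f \<mu>) X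
             \<ge> 1/4 * (norm (rgrad f X))\<^sup>2 + lam * \<mu> * penalty X
               + 1/4 * (norm (skew_part (g ** transpose X) ** X))\<^sup>2
               - (norm (g - nabla f X))\<^sup>2"
proof -
  define G where "G = nabla f X"
  define S where "S = transpose X ** X - mat 1"
  define A where "A = skew_part (g ** transpose X)"
  define B where "B = skew_part (G ** transpose X)"
  define M where "M = sym_part (transpose X ** G)"
  define c where "c = sqrt (1 + \<epsilon>)"
  have c: "c \<ge> 1" "c\<^sup>2 = 1 + \<epsilon>"
    using eps by (auto simp: c_def)
  have L0: "L \<ge> 0" "L' \<ge> 0"
    using lipschitz_on_nonneg[OF lip] norm_ge_zero[of "nabla f X"] bound by linarith+
  obtain H where H: "(nabla f has_derivative H) (at X)"
    using f by (auto simp: twice_differentiable_def differentiable_def)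
  have fd: "f differentiable at X"
    using f by (simp add: twice_differentiable_def)
  have Hlin: "linear H"
    using H by (rule has_derivative_linear)
  have Ssym: "transpose S = S"
    by (simp add: S_def transpose_gram_diff)
  have Askew: "transpose A = - A" and Msym: "transpose M = M"
    by (simp_all add: A_def M_def transpose_skew_part transpose_sym_part)
  have gram: "transpose X ** X = S + mat 1"
    by (simp add: S_def)
  \<comment> \<open>Moving \<open>X\<close> across turns this into a skew matrix paired with the
    symmetric \<open>X ** T ** transpose X\<close>.\<close>
  have orth: "(A ** X) \<bullet> (X ** T) = 0" if "transpose T = T" for T
    unfolding matrix_mul_right_adjoint
    by (rule skew_inner_sym[OF Askew]) (simp add: matrix_transpose_mul that matrix_mul_assoc)
  have AG: "(A ** X) \<bullet> G = A \<bullet> B"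
    by (simp add: matrix_mul_right_adjoint B_def inner_skew_part[OF Askew])
  have SM: "S \<bullet> (transpose X ** G) = S \<bullet> M"
    using sym_part_inner[OF Ssym, of "transpose X ** G"] by (simp add: M_def inner_commute)
  have PG: "(X ** S) \<bullet> G = S \<bullet> M"
    by (simp add: matrix_mul_left_adjoint SM)
  have PM: "(X ** S) \<bullet> (X ** M) = (S ** S) \<bullet> M + S \<bullet> M"
    by (simp add: matrix_mul_left_adjoint[of X] matrix_mul_left_adjoint[of S] matrix_mul_assoc gram
        matrix_mul_simps inner_add_right Ssym)
  have PGS: "(X ** S) \<bullet> (G ** S) = (S ** S) \<bullet> M"
  proof -
    have "(X ** S) \<bullet> (G ** S) = (S ** S) \<bullet> (transpose X ** G)"
      using matrix_mul_right_adjoint[of S S "transpose X ** G"]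
      by (simp add: matrix_mul_left_adjoint[of X] Ssym matrix_mul_assoc)
    also have "\<dots> = (S ** S) \<bullet> M"
      using sym_part_inner[of "S ** S" "transpose X ** G"]
      by (simp add: M_def inner_commute matrix_transpose_mul Ssym)
    finally show ?thesis .
  qed
  have Lam: "landing lam X g = A ** X + lam *\<^sub>R (X ** S)"
    by (simp add: landing_def nabla_penalty A_def S_def)
  \<comment> \<open>Along \<open>X ** S\<close> the first-order terms \<open>S \<bullet> M\<close>
    from \<open>PG\<close> and \<open>PM\<close> cancel, the effect of subtracting
    \<open>hterm\<close>. What remains of \<open>PM\<close> and \<open>PGS\<close> has coefficient 1
    + 1/2 = 3/2.\<close>
  have expand: "landing lam X g \<bullet> nabla (merit f \<mu>) X =
      A \<bullet> B - 1/2 * ((A ** X) \<bullet> (G ** S)) - 1/2 * (H (A ** X) \<bullet> (X ** S))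
      - 3/2 * lam * ((S ** S) \<bullet> M) - lam / 2 * (H (X ** S) \<bullet> (X ** S))
      + lam * \<mu> * (norm (X ** S))\<^sup>2"
    unfolding inner_nabla_merit[OF fd H] Lam
    by (simp add: inner_add_left linear_add[OF Hlin] linear_cmul[OF Hlin] orth[OF Ssym]
        orth[OF Msym] AG PG PM PGS power2_norm_eq_inner field_simps
        flip: G_def S_def M_def)
  have Hbound: "norm (H V \<bullet> (X ** S)) \<le> L * norm V * norm (X ** S)" for V
  \<comment> \<open>If the penalty gradient \<open>X ** S\<close> vanishes, both sides are zero;
    otherwise the derivative bound applies.\<close>
  proof (cases "X ** S = 0")
    case False
    then have "norm (H V) \<le> L * norm V"
      using St_nbhd_derivative_bound[OF lip H X] by (simp add: nabla_penalty S_def)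
    then show ?thesis
      using Cauchy_Schwarz_ineq2[of "H V" "X ** S"]
      by (smt (verit) mult_right_mono norm_ge_zero real_norm_def)
  qed simp
  have AX: "norm (A ** X) \<le> c * norm A" and BX: "norm (B ** X) \<le> c * norm B"
    unfolding c_def by (rule norm_mul_right_St_nbhd_le[OF X])+
  \<comment> \<open>The factor \<open>c \<ge> 1\<close> is inserted to match \<open>t2\<close>; the
    two halves in \<open>expand\<close> then add up to one cross term.\<close>
  have t1: "(A ** X) \<bullet> (G ** S) \<le> c * Lhat * norm A * norm (X ** S)"
  proof -
    have "(A ** X) \<bullet> (G ** S) = A \<bullet> (G ** transpose (X ** S))"
      by (simp add: matrix_mul_right_adjoint matrix_transpose_mul Ssym matrix_mul_assoc)
    also have "\<dots> \<le> norm A * (norm G * norm (X ** S))"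
      using norm_matrix_mul_le[of G "transpose (X ** S)"]
      by (intro order_trans[OF norm_cauchy_schwarz] mult_left_mono) (auto simp: norm_transpose)
    also have "\<dots> \<le> norm A * ((c * Lhat) * norm (X ** S))"
    proof -
      have "norm G \<le> 1 * Lhat"
        using bound by (simp add: G_def Lhat)
      also have "\<dots> \<le> c * Lhat"
        using c L0 Lhat by (intro mult_right_mono) auto
      finally show ?thesis
        by (intro mult_left_mono mult_right_mono) auto
    qed
    finally show ?thesis
      by (simp add: mult_ac)
  qed
  have t2: "H (A ** X) \<bullet> (X ** S) \<le> c * Lhat * norm A * norm (X ** S)"
  proof -
    have "L * norm (A ** X) \<le> Lhat * (c * norm A)"
      using AX L0 Lhat by (intro mult_mono) auto
    then have "L * norm (A ** X) * norm (X ** S) \<le> Lhat * (c * norm A) * norm (X ** S)"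
      by (rule mult_right_mono) simp
    then show ?thesis
      using Hbound[of "A ** X"] by (simp add: mult_ac)
  qed
  have t3: "(S ** S) \<bullet> M \<le> c * L' * (norm S)\<^sup>2"
  proof -
    have "norm M \<le> norm (transpose X ** G)"
      by (simp add: M_def norm_sym_part_le)
    also have "\<dots> \<le> c * norm G"
      unfolding c_def by (rule norm_transpose_mul_St_nbhd_le[OF X])
    also have "\<dots> \<le> c * L'"
      using c bound by (simp add: G_def)
    finally have "norm M \<le> c * L'" .
    then have "norm (S ** S) * norm M \<le> (norm S * norm S) * (c * L')"
      by (intro mult_mono norm_matrix_mul_le) auto
    then show ?thesis
      using norm_cauchy_schwarz[of "S ** S" M] by (simp add: power2_eq_square mult_ac)
  qed
  have t4: "H (X ** S) \<bullet> (X ** S) \<le> L * (norm (X ** S))\<^sup>2"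
    using Hbound[of "X ** S"] by (simp add: power2_eq_square mult_ac)
  \<comment> \<open>Twice \<open>A \<bullet> B\<close> is the sum of the squared norms minus
    \<open>(norm (A - B))\<^sup>2\<close>, which is at most
    \<open>2 * (norm (g - G))\<^sup>2\<close>; halving gives the error term coefficient 1.\<close>
  have polar: "A \<bullet> B + (norm (g - G))\<^sup>2 \<ge> 1/2 * (norm A)\<^sup>2 + 1/2 * (norm B)\<^sup>2"
  proof -
    have "A - B = skew_part ((g - G) ** transpose X)"
      by (simp add: A_def B_def skew_part_diff matrix_mul_simps)
    then have "norm (A - B) \<le> norm ((g - G) ** transpose X)"
      by (simp only: norm_skew_part_le)
    also have "\<dots> \<le> c * norm (g - G)"
      unfolding c_def by (rule norm_mul_transpose_St_nbhd_le[OF X])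
    finally have "(norm (A - B))\<^sup>2 \<le> (1 + \<epsilon>) * (norm (g - G))\<^sup>2"
      using power_mono[of "norm (A - B)" "c * norm (g - G)" 2] by (simp add: power_mult_distrib c)
    also have "\<dots> \<le> 2 * (norm (g - G))\<^sup>2"
      using eps by (intro mult_right_mono) auto
    finally show ?thesis
      using dot_norm_neg[of A B] by (simp add: field_simps)
  qed
  \<comment> \<open>For \<open>A\<close> the factor \<open>1 + \<epsilon>\<close> is kept, since the
    slack below 2 pays for the cross terms; for \<open>B\<close> it is rounded up to 2.\<close>
  have AX2: "(norm (A ** X))\<^sup>2 \<le> (1 + \<epsilon>) * (norm A)\<^sup>2"
    using power_mono[OF AX, of 2] by (simp add: power_mult_distrib c)
  have "(norm (B ** X))\<^sup>2 \<le> (1 + \<epsilon>) * (norm B)\<^sup>2"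
    using power_mono[OF BX, of 2] by (simp add: power_mult_distrib c)
  also have "\<dots> \<le> 2 * (norm B)\<^sup>2"
    using eps by (intro mult_right_mono) auto
  finally have BX2: "(norm (B ** X))\<^sup>2 \<le> 2 * (norm B)\<^sup>2" .
  have budget: "lam * \<mu> * (norm (X ** S))\<^sup>2 + (1 - \<epsilon>) / 4 * (norm A)\<^sup>2 \<ge>
      lam * \<mu> * (norm S)\<^sup>2 / 4 + lam * L * (norm (X ** S))\<^sup>2 / 2
      + 3/2 * lam * c * L' * (norm S)\<^sup>2 + c * Lhat * norm A * norm (X ** S)"
    unfolding c_def by (rule merit_budget[OF eps lam L0 norm_mul_St_nbhd(1)[OF X] mu])
  have t3': "3/2 * lam * ((S ** S) \<bullet> M) \<le> 3/2 * lam * c * L' * (norm S)\<^sup>2"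
    using mult_left_mono[OF t3, of "3/2 * lam"] lam by (simp add: mult_ac)
  have t4': "lam / 2 * (H (X ** S) \<bullet> (X ** S)) \<le> lam * L * (norm (X ** S))\<^sup>2 / 2"
    using mult_left_mono[OF t4, of "lam / 2"] lam by (simp add: mult_ac)
  have split: "(1 - \<epsilon>) / 4 * (norm A)\<^sup>2 = 1/2 * (norm A)\<^sup>2 - 1/4 * ((1 + \<epsilon>) * (norm A)\<^sup>2)"
    by (simp add: field_simps)
  have pen: "lam * \<mu> * penalty X = lam * \<mu> * (norm S)\<^sup>2 / 4"
    by (simp add: penalty_def S_def)
  have "1/4 * (norm (B ** X))\<^sup>2 + lam * \<mu> * penalty X + 1/4 * (norm (A ** X))\<^sup>2
      - (norm (g - G))\<^sup>2 \<le> landing lam X g \<bullet> nabla (merit f \<mu>) X"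
    unfolding expand pen using t1 t2 t3' t4' polar AX2 BX2 budget split by linarith
  then show ?thesis
    by (simp add: rgrad_def A_def B_def G_def)
qed

theorem lemma5p8:
  fixes D :: "nat \<Rightarrow> 'x measure"
    and F :: "real ^ 'p ^ 'n \<Rightarrow> 'x \<Rightarrow> real"
    and fi :: "nat \<Rightarrow> real ^ 'p ^ 'n \<Rightarrow> real"
    and f :: "real ^ 'p ^ 'n \<Rightarrow> real"
    and N :: nat and Li :: "nat \<Rightarrow> real"
    and L L' Lhat \<epsilon> lam \<mu> :: real
  assumes "CARD('p) \<le> CARD('n)" and "N \<ge> 1"
    and "\<And>i. i \<in> {1..N} \<Longrightarrow> prob_space (D i)"
    and "\<And>i X. i \<in> {1..N} \<Longrightarrow> integrable (D i) (F X)"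
    and "\<And>i X. i \<in> {1..N} \<Longrightarrow> fi i X = (\<integral>\<xi>. F X \<xi> \<partial>D i)"
    and "\<And>X. f X = 1 / real N * (\<Sum>i = 1..N. fi i X)"
    and "twice_differentiable f"
    and "\<And>i X. i \<in> {1..N} \<Longrightarrow> X \<in> St_nbhd \<epsilon> \<Longrightarrow>
           AE \<xi> in D i. (\<lambda>Y. F Y \<xi>) differentiable at X \<and> norm (nabla (\<lambda>Y. F Y \<xi>) X) \<le> L'"
    and "\<And>i X. i \<in> {1..N} \<Longrightarrow> X \<in> St_nbhd \<epsilon> \<Longrightarrow>
           fi i differentiable at X \<and>
           has_bochner_integral (D i) (\<lambda>\<xi>. nabla (\<lambda>Y. F Y \<xi>) X) (nabla (fi i) X)"
    and "\<And>i. i \<in> {1..N} \<Longrightarrow> (Li i)-lipschitz_on (St_nbhd \<epsilon>) (nabla (fi i))"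
    and "L-lipschitz_on (St_nbhd \<epsilon>) (nabla f)"
    and "0 < \<epsilon>" and "\<epsilon> < 3/4" and "0 < lam"
    and "Lhat = max L L'"
    and "\<mu> \<ge> 2 / (3 - 4 * \<epsilon>) *
           (L * (1 - \<epsilon>) + 3 * sqrt (1 + \<epsilon>) * L' + 2 * Lhat\<^sup>2 * ((1 + \<epsilon>) / lam))"
  shows "\<forall>X \<in> St_nbhd \<epsilon>. \<forall>g :: real ^ 'p ^ 'n.
           landing lam X g \<bullet> nabla (merit f \<mu>) X
             \<ge> 1/4 * (norm (rgrad f X))\<^sup>2 + lam * \<mu> * penalty X
               + 1/4 * (norm (skew_part (g ** transpose X) ** X))\<^sup>2
               - (norm (g - nabla f X))\<^sup>2"
proof (intro ballI allI)
  fix X g :: "real ^ 'p ^ 'n"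
  assume X: "X \<in> St_nbhd \<epsilon>"
  \<comment> \<open>The bound on the sampled gradients passes to \<open>nabla f X\<close> by
    expectation and averaging.\<close>
  have bd: "norm (nabla f X) \<le> L'"
    by (rule norm_nabla_average_le[where F = F, OF assms(2,3,6)]) (use assms(8,9) X in auto)
  show "landing lam X g \<bullet> nabla (merit f \<mu>) X
             \<ge> 1/4 * (norm (rgrad f X))\<^sup>2 + lam * \<mu> * penalty X
               + 1/4 * (norm (skew_part (g ** transpose X) ** X))\<^sup>2
               - (norm (g - nabla f X))\<^sup>2"
    by (rule landing_inner_nabla_merit_ge[OF assms(7) X bd assms(11-16)])
qed

end
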